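(* Let $\kappa\leq\lambda$ be infinite cardinals with $\kappa$ regular, and assume $\lambda^{<\kappa}=\lambda<\mathfrak{c}=2^{\aleph_0}$. Then there is a continuous $\omega_1$-Dirac weak $\lambda^+$-measure space $({}^{\kappa}\lambda,\mathfrak{M},\mu)$ on ${}^{\kappa}\lambda$ (with $\mu$ taking values in some positively totally ordered monoid $\mathbb{S}$ with an infinitary sum $\mathsf{Sum}$).
   Context: **Topology.** ${}^{\kappa}\lambda$ is the set of sequences of elements of $\lambda$ of length $\kappa$, with the bounded topology, generated by the cones $\mathbf{N}_s=\{x\in{}^{\kappa}\lambda\mid s\subseteq x\}$ for $s\in{}^{<\kappa}\lambda=\bigcup_{\alpha<\kappa}{}^{\alpha}\lambda$. **Monoids and sums.** A positively totally ordered monoid is $\mathbb{S}=(S,0,+,\leq)$ where $+$ is associative (not necessarily commutative) with neutral element $0$, $\leq$ is a total order, $a\leq b$ and $c\leq d$ imply $a+c\leq b+d$, $0$ is the minimum of $\leq$, and $S\neq\{0\}$. ${}^{<\mathrm{On}}\mathbb{S}$ is the class of all sequences of elements of $S$ of ordinal length; $\mathrm{lh}(s)$ is the length of $s$. An infinitary sum on $\mathbb{S}$ is a partial function $\mathsf{Sum}:{}^{<\mathrm{On}}\mathbb{S}\to\mathbb{S}$ such that: (S1) $\mathsf{Sum}(\emptyset)=0$ and $\mathsf{Sum}(s)=s_0+\dots+s_n$ for every non-empty finite $s=(s_i)_{i\leq n}\in\mathrm{dom}(\mathsf{Sum})$; (S2) (continuity) for all $s\in\mathrm{dom}(\mathsf{Sum})$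 of limit length, if $s\restriction\alpha\in\mathrm{dom}(\mathsf{Sum})$ for cofinally many $\alpha<\mathrm{lh}(s)$, then $\mathsf{Sum}(s)=\sup\{\mathsf{Sum}(s\restriction\alpha)\mid\alpha<\mathrm{lh}(s),\ s\restriction\alpha\in\mathrm{dom}(\mathsf{Sum})\}$. **Measures.** A weakly $\lambda^+$-measurable space is a pair $(X,\mathfrak{M})$ where $X$ is a topological space and $\mathfrak{M}$ is a family of subsets of $X$ closed under unions of size $\leq\lambda$ and containing all open subsets of $X$. A $\lambda^+$-measure on it (with values in $(\mathbb{S},\mathsf{Sum})$) is a partial function $\mu:\mathscr{P}(X)\to\mathbb{S}$ with $\mathfrak{M}\subseteq\mathrm{dom}(\mu)$ such that: (M1) $\mu(\emptyset)=0$; (M2) $\mu(X)>0$; (M3) $A\subseteq B$ implies $\mu(A)\leq\mu(B)$ for all $A,B\in\mathfrak{M}$; (M4) for every family $(A_i)_{i<\gamma}$ of pairwise disjoint sets of $\mathfrak{M}$ of length an ordinal $\gamma<\lambda^+$, we have $\langle\mu(A_i)\mid i<\gamma\rangle\in\mathrm{dom}(\mathsf{Sum})$ and $\mu(\bigcup_{i<\gamma}A_i)=\mathsf{Sum}(\langle\mu(A_i)\mid i<\gamma\rangle)$; (M5) for every $x\in X$ with $\{x\}\in\mathfrak{M}$ and every open local basis $\{A_i\mid i<\gamma\}$ at $x$ with $\gamma<\lambda^+$, $\mu(\{x\})=\inf_{i<\gamma}\mu(A_i)$. Then $(X,\mathfrak{M},\mu)$ is called a weak $\lambda^+$-measure space.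 It is continuous if $\{x\}\in\mathfrak{M}$ and $\mu(\{x\})=0$ for every $x\in X$. The support of $\mu$ is $\mathrm{supp}(\mu)=X\setminus\bigcup\{O\mid O\text{ open},\ \mu(O)=0\}$. For a cardinal $\gamma$, $\mu$ is $\gamma$-Dirac if $\mathrm{supp}(\mu)$ has weight strictly less than $\gamma$. *)

theory Defs
  imports "HOL-Algebra.Group" "HOL-Analysis.Abstract_Topology"
begin

unbundle cardinal_syntax

section \<open>Ordinals, sequences and the bounded topology\<close>

text \<open>
  Cardinals are well-order relations satisfying \<open>Card_order\<close>. A well-order \<open>W\<close> also serves as the
  collection of all ordinals below its order type: \<open>\<alpha> \<in> Field W\<close> stands for the order type of
  \<open>underS W \<alpha>\<close>, the set of ordinals smaller than \<open>\<alpha>\<close>.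
\<close>

abbreviation ord_at :: "'o rel \<Rightarrow> 'o \<Rightarrow> 'o rel" where
  "ord_at W \<alpha> \<equiv> Restr W (underS W \<alpha>)"

definition is_limit :: "'o rel \<Rightarrow> 'o \<Rightarrow> bool" where
  "is_limit W \<alpha> \<longleftrightarrow> \<alpha> \<in> Field W \<and> underS W \<alpha> \<noteq> {} \<and>
     (\<forall>\<beta>\<in>underS W \<alpha>. \<exists>\<gamma>\<in>underS W \<alpha>. \<beta> \<in> underS W \<gamma>)"

text \<open>A sequence of ordinal length is a pair of its length and an extensional function.\<close>

type_synonym ('o, 'a) tseq = "'o \<times> ('o \<Rightarrow> 'a)"

definition seqs_lt :: "'o rel \<Rightarrow> 'a set \<Rightarrow> ('o, 'a) tseq set" where
  "seqs_lt W A = (SIGMA \<alpha>:Field W. underS W \<alpha> \<rightarrow>\<^sub>E A)"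

definition seq_restrict :: "'o rel \<Rightarrow> ('o \<Rightarrow> 'a) \<Rightarrow> 'o \<Rightarrow> ('o, 'a) tseq" where
  "seq_restrict W f \<alpha> = (\<alpha>, restrict f (underS W \<alpha>))"

definition seqs :: "'k rel \<Rightarrow> 'l rel \<Rightarrow> ('k \<Rightarrow> 'l) set" where
  "seqs kappa lam = (Field kappa \<rightarrow>\<^sub>E Field lam)"

definition cone :: "'k rel \<Rightarrow> 'l rel \<Rightarrow> ('k, 'l) tseq \<Rightarrow> ('k \<Rightarrow> 'l) set" where
  "cone kappa lam s = {x \<in> seqs kappa lam. seq_restrict kappa x (fst s) = s}"

definition bounded_topology :: "'k rel \<Rightarrow> 'l rel \<Rightarrow> ('k \<Rightarrow> 'l) topology" where
  "bounded_topology kappa lam =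
     topology_generated_by (cone kappa lam ` seqs_lt kappa (Field lam))"

lemma topspace_bounded_topology:
  assumes "Well_order kappa" "Field kappa \<noteq> {}"
  shows "topspace (bounded_topology kappa lam) = seqs kappa lam"
proof -
  have wo: "wo_rel kappa"
    using assms(1) by (simp add: wo_rel_def)
  define z where "z = wo_rel.minim kappa (Field kappa)"
  have z: "z \<in> Field kappa"
    unfolding z_def by (rule wo_rel.minim_in[OF wo subset_refl assms(2)])
  have zempty: "underS kappa z = {}"
  proof (rule ccontr)
    assume "underS kappa z \<noteq> {}"
    then obtain b where b: "b \<noteq> z" "(b, z) \<in> kappa"
      by (auto simp: underS_def)
    have "(z, b) \<in> kappa"
      unfolding z_def by (rule wo_rel.minim_least[OF wo subset_refl FieldI1[OF b(2)]])
    then show False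
      using b antisymD[OF wo_rel.ANTISYM[OF wo]] by blast
  qed
  have "x \<in> \<Union>(cone kappa lam ` seqs_lt kappa (Field lam))" if x: "x \<in> seqs kappa lam" for x
  proof (rule UN_I)
    show "seq_restrict kappa x z \<in> seqs_lt kappa (Field lam)"
      using z zempty by (simp add: seq_restrict_def seqs_lt_def restrict_def)
    show "x \<in> cone kappa lam (seq_restrict kappa x z)"
      using x by (simp add: cone_def seq_restrict_def)
  qed
  moreover have "\<Union>(cone kappa lam ` seqs_lt kappa (Field lam)) \<subseteq> seqs kappa lam"
    unfolding cone_def by blast
  ultimately show ?thesis
    unfolding bounded_topology_def topology_generated_by_topspace by blast
qed

definition is_base :: "'a topology \<Rightarrow> 'a set set \<Rightarrow> bool" where
  "is_base X \<B> \<longleftrightarrow> (\<forall>V\<in>\<B>. openin X V) \<and>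
     (\<forall>U x. openin X U \<and> x \<in> U \<longrightarrow> (\<exists>V\<in>\<B>. x \<in> V \<and> V \<subseteq> U))"

definition is_local_base :: "'a topology \<Rightarrow> 'a \<Rightarrow> 'a set set \<Rightarrow> bool" where
  "is_local_base X x \<B> \<longleftrightarrow> (\<forall>V\<in>\<B>. openin X V \<and> x \<in> V) \<and>
     (\<forall>U. openin X U \<and> x \<in> U \<longrightarrow> (\<exists>V\<in>\<B>. V \<subseteq> U))"

text \<open>The least cardinality of a base, determined up to \<open>=o\<close>.\<close>

definition weight :: "'a topology \<Rightarrow> 'a set rel" where
  "weight X = (SOME w. (\<exists>\<B>. is_base X \<B> \<and> w = |\<B>| ) \<and> (\<forall>\<B>. is_base X \<B> \<longrightarrow> w \<le>o |\<B>| ))"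

lemma weight_works:
  "(\<exists>\<B>. is_base X \<B> \<and> weight X = |\<B>| ) \<and> (\<forall>\<B>. is_base X \<B> \<longrightarrow> weight X \<le>o |\<B>| )"
proof -
  let ?R = "{|\<B>| | \<B>. is_base X \<B>}"
  have "is_base X {U. openin X U}"
    by (auto simp: is_base_def)
  then have "?R \<noteq> {}" by blast
  moreover have "\<forall>r\<in>?R. Card_order r" using card_of_Card_order by blast
  ultimately obtain w where "w \<in> ?R" "\<forall>r\<in>?R. w \<le>o r"
    using exists_minim_Card_order[of ?R] by blast
  then have "\<exists>w. (\<exists>\<B>. is_base X \<B> \<and> w = |\<B>| ) \<and> (\<forall>\<B>. is_base X \<B> \<longrightarrow> w \<le>o |\<B>| )"
    by blast
  then show ?thesis
    unfolding weight_def by (rule someI_ex)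
qed


section \<open>Positively totally ordered monoids and infinitary sums\<close>

text \<open>
  The monoid is written with the multiplicative notation of \<^locale>\<open>monoid\<close>: \<open>\<otimes>\<close> is the sum and \<open>\<one>\<close> is the
  element \<open>0\<close>. For a measure on a space \<open>X\<close> it is no restriction to take the carrier inside the type of
  sets of points of \<open>X\<close>: the submonoid generated by the values on the measurable sets contains every
  supremum and infimum that the axioms of a measure mention, and is not larger than the power set of
  an infinite \<open>X\<close>.
\<close>

record 's ordered_monoid = "'s monoid" +
  leq :: "'s rel"

locale pto_monoid = monoid S for S :: "('s, 'm) ordered_monoid_scheme" (structure) +
  assumes linear_order: "linear_order_on (carrier S) (leq S)"
    and add_mono: "\<lbrakk>(a, b) \<in> leq S; (c, d) \<in> leq S\<rbrakk> \<Longrightarrow> (a \<otimes> c, b \<otimes> d) \<in> leq S"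
    and zero_least: "a \<in> carrier S \<Longrightarrow> (\<one>, a) \<in> leq S"
    and nontrivial: "carrier S \<noteq> {\<one>}"

definition is_sup :: "'s rel \<Rightarrow> 's set \<Rightarrow> 's \<Rightarrow> bool" where
  "is_sup r B u \<longleftrightarrow> u \<in> Field r \<and> (\<forall>b\<in>B. (b, u) \<in> r) \<and>
     (\<forall>v\<in>Field r. (\<forall>b\<in>B. (b, v) \<in> r) \<longrightarrow> (u, v) \<in> r)"

definition is_inf :: "'s rel \<Rightarrow> 's set \<Rightarrow> 's \<Rightarrow> bool" where
  "is_inf r B u \<longleftrightarrow> is_sup (r\<inverse>) B u"

text \<open>
  The order \<open>W\<close> plays the role of the class of ordinals: \<open>Sum\<close> is a partial function on the sequences
  in \<open>S\<close> whose length is an ordinal represented in \<open>W\<close>.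
\<close>

locale infinitary_sum = pto_monoid S for S :: "('s, 'm) ordered_monoid_scheme" (structure) +
  fixes W :: "'o rel"
    and Sum :: "('o, 's) tseq \<Rightarrow> 's option"
  assumes well_order: "Well_order W"
    and dom_Sum: "dom Sum \<subseteq> seqs_lt W (carrier S)"
    and ran_Sum: "ran Sum \<subseteq> carrier S"
    and Sum_empty: "\<lbrakk>\<alpha> \<in> Field W; underS W \<alpha> = {}\<rbrakk> \<Longrightarrow> Sum (\<alpha>, \<lambda>_. undefined) = Some \<one>"
    \<comment> \<open>\<open>ns\<close> lists the indices of \<open>s\<close> in increasing order\<close>
    and Sum_finite:
      "\<lbrakk>(\<alpha>, s) \<in> dom Sum; ns \<noteq> []; set ns = underS W \<alpha>; sorted_wrt (\<lambda>i j. i \<in> underS W j) ns\<rbrakk>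
        \<Longrightarrow> Sum (\<alpha>, s) = Some (foldr (\<otimes>) (map s ns) \<one>)"
    and Sum_limit:
      "\<lbrakk>(\<alpha>, s) \<in> dom Sum; is_limit W \<alpha>;
        \<And>\<beta>. \<beta> \<in> underS W \<alpha> \<Longrightarrow> \<exists>\<gamma>\<in>underS W \<alpha>. (\<beta>, \<gamma>) \<in> W \<and> seq_restrict W s \<gamma> \<in> dom Sum\<rbrakk>
        \<Longrightarrow> is_sup (leq S)
              {the (Sum (seq_restrict W s \<gamma>)) | \<gamma>. \<gamma> \<in> underS W \<alpha> \<and> seq_restrict W s \<gamma> \<in> dom Sum}
              (the (Sum (\<alpha>, s)))"


section \<open>Measures\<close>

locale weakly_measurable_space =
  fixes lam :: "'l rel" and X :: "'x topology" and \<MM> :: "'x set set"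
  assumes measurable_subset: "\<MM> \<subseteq> Pow (topspace X)"
    and Union_measurable: "\<lbrakk>\<A> \<subseteq> \<MM>; |\<A>| \<le>o lam\<rbrakk> \<Longrightarrow> \<Union>\<A> \<in> \<MM>"
    and open_measurable: "openin X U \<Longrightarrow> U \<in> \<MM>"

text \<open>An ordinal \<open>\<gamma>\<close> of \<open>W\<close> is below the successor cardinal of \<open>lam\<close> iff \<open>ord_at W \<gamma> <o cardSuc lam\<close>.\<close>

locale weak_measure_space =
  infinitary_sum S W Sum + weakly_measurable_space lam X \<MM>
  for S :: "('s, 'm) ordered_monoid_scheme" (structure)
    and W :: "'o rel"
    and Sum :: "('o, 's) tseq \<Rightarrow> 's option"
    and lam :: "'l rel" and X :: "'x topology" and \<MM> :: "'x set set" +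
  fixes \<mu> :: "'x set \<Rightarrow> 's option"
  assumes dom_subset: "dom \<mu> \<subseteq> Pow (topspace X)"
    and ran_subset: "ran \<mu> \<subseteq> carrier S"
    and measurable_dom: "\<MM> \<subseteq> dom \<mu>"
    and measure_empty: "\<mu> {} = Some \<one>"
    and measure_space_pos: "(\<one>, the (\<mu> (topspace X))) \<in> leq S" "the (\<mu> (topspace X)) \<noteq> \<one>"
    and measure_mono: "\<lbrakk>A \<in> \<MM>; B \<in> \<MM>; A \<subseteq> B\<rbrakk> \<Longrightarrow> (the (\<mu> A), the (\<mu> B)) \<in> leq S"
    and measure_Union:
      "\<lbrakk>\<gamma> \<in> Field W; ord_at W \<gamma> <o cardSuc lam;
        \<And>i. i \<in> underS W \<gamma> \<Longrightarrow> F i \<in> \<MM>;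
        \<And>i j. \<lbrakk>i \<in> underS W \<gamma>; j \<in> underS W \<gamma>; i \<noteq> j\<rbrakk> \<Longrightarrow> F i \<inter> F j = {}\<rbrakk>
        \<Longrightarrow> seq_restrict W (\<lambda>i. the (\<mu> (F i))) \<gamma> \<in> dom Sum \<and>
            \<mu> (\<Union>i\<in>underS W \<gamma>. F i) = Sum (seq_restrict W (\<lambda>i. the (\<mu> (F i))) \<gamma>)"
    and measure_singleton:
      "\<lbrakk>x \<in> topspace X; {x} \<in> \<MM>; \<gamma> \<in> Field W; ord_at W \<gamma> <o cardSuc lam;
        is_local_base X x (F ` underS W \<gamma>)\<rbrakk>
        \<Longrightarrow> is_inf (leq S) ((\<lambda>i. the (\<mu> (F i))) ` underS W \<gamma>) (the (\<mu> {x}))"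

definition continuous_measure ::
  "('s, 'm) ordered_monoid_scheme \<Rightarrow> 'x topology \<Rightarrow> 'x set set \<Rightarrow> ('x set \<Rightarrow> 's option) \<Rightarrow> bool" where
  "continuous_measure S X \<MM> \<mu> \<longleftrightarrow> (\<forall>x\<in>topspace X. {x} \<in> \<MM> \<and> \<mu> {x} = Some \<one>\<^bsub>S\<^esub>)"

definition measure_support ::
  "('s, 'm) ordered_monoid_scheme \<Rightarrow> 'x topology \<Rightarrow> ('x set \<Rightarrow> 's option) \<Rightarrow> 'x set" where
  "measure_support S X \<mu> = topspace X - \<Union>{U. openin X U \<and> \<mu> U = Some \<one>\<^bsub>S\<^esub>}"

definition Dirac ::
  "'c rel \<Rightarrow> ('s, 'm) ordered_monoid_scheme \<Rightarrow> 'x topology \<Rightarrow> ('x set \<Rightarrow> 's option) \<Rightarrow> bool" where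
  "Dirac gam S X \<mu> \<longleftrightarrow> weight (subtopology X (measure_support S X \<mu>)) <o gam"

end

theory Submission
  imports Defs "HOL-Analysis.Analysis"
begin

text \<open>
  Since \<open>2 ^ \<omega> > \<lambda> = \<lambda> ^ (< \<kappa>)\<close>, necessarily \<open>\<kappa> = \<omega>\<close>. Lebesgue measure on \<open>[0, 1)\<close> is pushed forward to the
  sequences along an injection with values in \<open>\<^sup>\<omega>E\<close> for a countable set \<open>E\<close> of letters. Its restriction to the
  open sets extends to the family of all sets \<open>U \<union> B\<close> with \<open>U\<close> open and \<open>|B| \<le> \<lambda>\<close> by ignoring \<open>B\<close>. This is
  well defined because a Borel set of reals of cardinality less than the continuum is null, which
  is where \<open>\<lambda> < 2 ^ \<omega>\<close> enters. No \<open>\<lambda>\<^sup>+\<close>-additivity of Lebesgue measure itself is needed, as only countably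
  many members of a disjoint family of open sets can meet the separable support.
\<close>

section \<open>Borel sets smaller than the continuum\<close>

lemma nat_sets_ordLeq_greaterThanAtMost:
  fixes m :: real
  assumes "0 < m"
  shows "|UNIV :: nat set set| \<le>o |{0<..m}|"
proof -
  have "(UNIV :: real set) \<approx> {0<..m}"
    using eqpoll_real_subset[of 0 m "{0<..m}"] assms by (auto simp: eqpoll_sym)
  then have "(UNIV :: nat set set) \<lesssim> {0<..m}"
    using nat_sets_eqpoll_reals eqpoll_trans eqpoll_imp_lepoll by blast
  then show ?thesis
    unfolding lepoll_def by (simp add: card_of_ordLeq)
qed

text \<open>Inner regularity gives a compact subset \<open>K\<close> of positive measure
  \<open>m\<close>. The cumulative function t \<mapsto> |K \<inter> (-\<infinity>, t]| is continuous
  and takes every value in (0, m] at a point of \<open>K\<close>, so \<open>K\<close> maps onto a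
  set of size continuum.\<close>

lemma positive_measure_imp_continuum:
  fixes D :: "real set"
  assumes "D \<in> sets borel" and "emeasure lborel D \<noteq> 0"
  shows "|UNIV :: nat set set| \<le>o |D|"
proof -
  obtain K where K: "K \<subseteq> D" "compact K" and pos: "measure lborel K > 0"
  proof -
    \<comment> \<open>Countably many bounded pieces cover \<open>D\<close>, so one is not null.
      Boundedness makes its measure finite and will make the closed subset compact.\<close>
    obtain n :: nat where n: "emeasure lborel (D \<inter> {- real n..real n}) \<noteq> 0"
    proof (rule ccontr)
      assume "\<not> thesis"
      then have "emeasure lborel (D \<inter> {- real n..real n}) = 0" for n
        using that by blast
      then have "(\<Union>n. D \<inter> {- real n..real n}) \<in> null_sets lborel"
        using assms(1) by (intro null_sets_UN) (auto simp: null_sets_def)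
      moreover have "(\<Union>n. D \<inter> {- real n..real n}) = D"
      proof -
        have "\<exists>n. x \<in> {- real n..real n}" for x
        proof -
          obtain n where "\<bar>x\<bar> \<le> real n"
            using real_arch_simple by blast
          then show ?thesis by (intro exI[of _ n]) auto
        qed
        then show ?thesis by auto
      qed
      ultimately show False
        using assms(2) by auto
    qed
    let ?E = "D \<inter> {- real n..real n}"
    have Eb: "?E \<in> sets borel" using assms(1) by auto
    have fin: "emeasure lborel ?E < \<infinity>"
      by (rule le_less_trans[OF emeasure_mono[of _ "{- real n..real n}"]])
        (auto simp: emeasure_lborel_Icc_eq)
    then have "emeasure lborel ?E = ennreal (measure lborel ?E)"
      by (intro emeasure_eq_ennreal_measure) auto
    moreover from this n have "measure lborel ?E > 0"
      by (auto simp: zero_less_measure_iff)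
    \<comment> \<open>As \<open>e\<close> lies strictly below the measure of \<open>?E\<close>, a
      closed subset that misses less than \<open>e\<close> cannot be null.\<close>
    ultimately obtain e where e: "0 < e" "ennreal e < emeasure lborel ?E"
      using dense[of 0 "measure lborel ?E"] by (auto simp: ennreal_less_iff)
    obtain T where T: "closed T" "T \<subseteq> ?E" "?E - T \<in> lmeasurable" "emeasure lebesgue (?E - T) < ennreal e"
      using sets_lebesgue_inner_closed[of ?E e] Eb e(1) by auto
    show thesis
    proof
      show "T \<subseteq> D" using T by auto
      show "compact T"
        using T by (meson bounded_closed_interval bounded_subset compact_eq_bounded_closed le_inf_iff)
      have "emeasure lborel T \<noteq> 0"
      proof
        assume "emeasure lborel T = 0"
        moreover have "emeasure lborel ?E \<le> emeasure lborel T + emeasure lborel (?E - T)"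
          using emeasure_subadditive[of T lborel "?E - T"] T(1,2) Eb
          by (simp add: Un_absorb1 borel_closed)
        moreover have "emeasure lborel (?E - T) = emeasure lebesgue (?E - T)"
          using Eb T(1) by (simp add: borel_closed sets.Diff)
        ultimately show False using T(4) e(2) by auto
      qed
      moreover have "emeasure lborel T < \<infinity>"
        by (rule le_less_trans[OF emeasure_mono[OF T(2)] fin]) (use Eb in auto)
      ultimately show "measure lborel T > 0"
        by (simp add: measure_def enn2real_positive_iff zero_less_iff_neq_zero)
    qed
  qed
  \<comment> \<open>a continuous function constant off \<open>K\<close>, so that all its positive values are attained on \<open>K\<close>\<close>
  define F where "F t = measure lborel (K \<inter> {..t})" for t
  have fm: "K \<inter> A \<in> fmeasurable lborel" if "A \<in> sets borel" for A
    using fmeasurable_Int_fmeasurable[OF fmeasurable_compact[OF K(2)]] that by simp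
  have Kb: "K \<in> sets borel"
    using K(2) by (simp add: borel_closed compact_imp_closed)
  \<comment> \<open>From s to t the set grows by at most an interval of length t - s, so
    \<open>F\<close> is 1-Lipschitz.\<close>
  have mono: "F s \<le> F t" and lip: "F t - F s \<le> t - s" if "s \<le> t" for s t
  proof -
    show "F s \<le> F t"
      unfolding F_def using that by (intro measure_mono_fmeasurable fm) (use Kb in auto)
    have "F t \<le> measure lborel ((K \<inter> {..s}) \<union> {s..t})"
      unfolding F_def
      by (intro measure_mono_fmeasurable fmeasurable.Un fm fmeasurable_compact compact_Icc) (use Kb in auto)
    also have "\<dots> \<le> F s + measure lborel {s..t}"
      unfolding F_def by (intro measure_Un_le) (use Kb in auto)
    finally show "F t - F s \<le> t - s"
      using that by simp
  qed
  have cont: "continuous_on A F" for A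
  proof (rule continuous_on_subset[OF _ subset_UNIV])
    have "dist (F s) (F t) \<le> 1 * dist s t" for s t
      using mono[of s t] lip[of s t] mono[of t s] lip[of t s]
      by (cases "s \<le> t") (auto simp: dist_real_def)
    then have "1-lipschitz_on UNIV F"
      by (intro lipschitz_onI) auto
    then show "continuous_on UNIV F"
      by (rule lipschitz_on_continuous_on)
  qed
  obtain B where "\<And>x. x \<in> K \<Longrightarrow> \<bar>x\<bar> \<le> B"
    using compact_imp_bounded[OF K(2)] by (auto simp: bounded_iff)
  then have B: "K \<subseteq> {-B..B}"
    by (auto simp: abs_le_iff minus_le_iff[of B])
  let ?m = "measure lborel K"
  have "{0<..?m} \<subseteq> F ` K"
  proof
    fix y assume y: "y \<in> {0<..?m}"
    \<comment> \<open>The maximum keeps the endpoints in order whatever the sign of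
      \<open>B\<close>.\<close>
    have "K \<inter> {..-B - 1} = {}" "K \<inter> {..max B (- B - 1)} = K"
      using B by fastforce+
    then have "F (- B - 1) = 0" "F (max B (-B-1)) = ?m"
      by (simp_all add: F_def)
    then obtain t where t: "F t = y"
      using IVT'[of F "-B-1" y "max B (-B-1)"] cont y by auto
    \<comment> \<open>The point \<open>t\<close> may lie off \<open>K\<close>. Moving down to the
      greatest point of \<open>?C\<close> leaves \<open>F\<close> unchanged; \<open>?C\<close> is
      non-empty because y > 0.\<close>
    let ?C = "K \<inter> {..t}"
    have "compact ?C" "?C \<noteq> {}"
      using K(2) t y by (auto simp: F_def compact_Int_closed)
    then obtain s where s: "s \<in> ?C" "\<And>u. u \<in> ?C \<Longrightarrow> u \<le> s"
      using compact_attains_sup[of ?C] by metis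
    then have "K \<inter> {..s} = ?C" by force
    then have "F s = y" using t by (simp add: F_def)
    then show "y \<in> F ` K" using s by auto
  qed
  then have "|{0<..?m}| \<le>o |K|"
    by (rule ordLeq_transitive[OF card_of_mono1 card_of_image])
  then show ?thesis
    by (rule ordLeq_transitive[OF ordLeq_transitive[OF nat_sets_ordLeq_greaterThanAtMost[OF pos]]
          card_of_mono1[OF K(1)]])
qed

text \<open>The index set may be uncountable. Empty members contribute 0, and the remaining
  countable subfamily falls under ordinary countable additivity.\<close>

lemma infsum_emeasure:
  fixes V :: "'i \<Rightarrow> 'a set"
  assumes meas: "\<And>i. i \<in> I \<Longrightarrow> V i \<in> sets M"
    and disj: "disjoint_family_on V I"
    and count: "countable {i \<in> I. V i \<noteq> {}}"
  shows "emeasure M (\<Union>i\<in>I. V i) = (\<Sum>\<^sub>\<infinity>i\<in>I. emeasure M (V i))"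
proof -
  define J where "J = {i \<in> I. V i \<noteq> {}}"
  have J: "J \<subseteq> I" "countable J" "disjoint_family_on V J"
    using count disjoint_family_on_mono[OF _ disj] by (auto simp: J_def)
  have "emeasure M (\<Union>i\<in>J. V i) = (\<Sum>\<^sub>\<infinity>i\<in>J. emeasure M (V i))"
  proof (cases "finite J")
    case True
    then show ?thesis
      using sum_emeasure[of V J M] J meas by (simp add: image_subsetI subsetD[OF J(1)])
  next
    case False
    define f where "f = from_nat_into J"
    have f: "bij_betw f UNIV J"
      using J(2) False unfolding f_def by (rule bij_betw_from_nat_into)
    have "emeasure M (\<Union>n. V (f n)) = (\<Sum>n. emeasure M (V (f n)))"
    proof (rule suminf_emeasure[symmetric])
      show "range (\<lambda>n. V (f n)) \<subseteq> sets M"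
        using f J meas by (auto simp: bij_betw_def)
      show "disjoint_family (\<lambda>n. V (f n))"
        using f J(3) by (auto simp: disjoint_family_on_def bij_betw_def inj_def)
    qed
    also have "\<dots> = (\<Sum>\<^sub>\<infinity>n. emeasure M (V (f n)))"
      by (rule sums_unique[symmetric]) (intro has_sum_imp_sums has_sum_infsum nonneg_summable_on_complete zero_le)
    also have "\<dots> = (\<Sum>\<^sub>\<infinity>i\<in>J. emeasure M (V i))"
      by (rule infsum_reindex_bij_betw[OF f])
    also have "(\<Union>n. V (f n)) = (\<Union>i\<in>J. V i)"
      using f by (auto simp: bij_betw_def)
    finally show ?thesis .
  qed
  also have "(\<Union>i\<in>J. V i) = (\<Union>i\<in>I. V i)"
    by (auto simp: J_def)
  also have "(\<Sum>\<^sub>\<infinity>i\<in>J. emeasure M (V i)) = (\<Sum>\<^sub>\<infinity>i\<in>I. emeasure M (V i))"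
    by (rule infsum_cong_neutral) (auto simp: J_def)
  finally show ?thesis .
qed

lemma infsum_ennreal_eq_SUP:
  fixes f :: "'i \<Rightarrow> ennreal"
  shows "infsum f A = (SUP F\<in>{F. finite F \<and> F \<subseteq> A}. sum f F)"
  by (rule nonneg_infsum_complete) auto

section \<open>Extended nonnegative reals as values\<close>

text \<open>The structure of [0, \<infinity>] transported along \<iota>, because the theorem
  prescribes the type that contains the carrier.\<close>

definition ennreal_monoid :: "(ennreal \<Rightarrow> 's) \<Rightarrow> 's ordered_monoid" where
  "ennreal_monoid \<iota> =
     \<lparr>carrier = range \<iota>, monoid.mult = (\<lambda>a b. \<iota> (inv_into UNIV \<iota> a + inv_into UNIV \<iota> b)), one = \<iota> 0,
      leq = {(\<iota> a, \<iota> b) | a b. a \<le> b}\<rparr>"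

text \<open>Unordered sums in [0, \<infinity>] always exist, so every sequence over the carrier with
  length in \<open>W\<close> gets a sum.\<close>

definition ennreal_Sum :: "(ennreal \<Rightarrow> 's) \<Rightarrow> 'o rel \<Rightarrow> ('o, 's) tseq \<Rightarrow> 's option" where
  "ennreal_Sum \<iota> W s =
     (if s \<in> seqs_lt W (range \<iota>)
      then Some (\<iota> (\<Sum>\<^sub>\<infinity>i\<in>underS W (fst s). inv_into UNIV \<iota> (snd s i))) else None)"

lemma ennreal_monoid_simps [simp]:
  "carrier (ennreal_monoid \<iota>) = range \<iota>"
  "\<one>\<^bsub>ennreal_monoid \<iota>\<^esub> = \<iota> 0"
  "a \<otimes>\<^bsub>ennreal_monoid \<iota>\<^esub> b = \<iota> (inv_into UNIV \<iota> a + inv_into UNIV \<iota> b)"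
  by (simp_all add: ennreal_monoid_def)

lemma leq_ennreal_monoid_iff [simp]:
  assumes "inj \<iota>"
  shows "(\<iota> a, \<iota> b) \<in> leq (ennreal_monoid \<iota>) \<longleftrightarrow> a \<le> b"
  using assms by (auto simp: ennreal_monoid_def inj_eq)

lemma leq_ennreal_monoidE:
  assumes "(x, y) \<in> leq (ennreal_monoid \<iota>)"
  obtains a b where "x = \<iota> a" "y = \<iota> b" "a \<le> b"
  using assms by (auto simp: ennreal_monoid_def)

lemma Field_leq_ennreal_monoid [simp]: "Field (leq (ennreal_monoid \<iota>)) = range \<iota>"
  by (auto simp: ennreal_monoid_def Field_def)

lemma pto_monoid_ennreal_monoid:
  assumes "inj \<iota>"
  shows "pto_monoid (ennreal_monoid \<iota>)"
proof -
  let ?S = "ennreal_monoid \<iota>"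
  interpret monoid ?S
    using assms by unfold_locales (auto simp: add.assoc)
  show ?thesis
  proof
    show "linear_order_on (carrier ?S) (leq ?S)"
      using assms
      by (auto simp: linear_order_on_def partial_order_on_def preorder_on_def refl_on_def total_on_def
          inj_eq[OF assms] intro!: transI antisymI elim!: leq_ennreal_monoidE)
    show "(a \<otimes>\<^bsub>?S\<^esub> c, b \<otimes>\<^bsub>?S\<^esub> d) \<in> leq ?S" if "(a, b) \<in> leq ?S" "(c, d) \<in> leq ?S" for a b c d
      using that assms by (auto simp: add_mono elim!: leq_ennreal_monoidE)
    show "(\<one>\<^bsub>?S\<^esub>, a) \<in> leq ?S" if "a \<in> carrier ?S" for a
      using that assms by auto
    have "\<iota> 1 \<noteq> \<iota> 0"
      using assms by (simp add: inj_eq)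
    then show "carrier ?S \<noteq> {\<one>\<^bsub>?S\<^esub>}"
      by auto
  qed
qed

lemma is_sup_ennreal_monoid:
  assumes "inj \<iota>"
  shows "is_sup (leq (ennreal_monoid \<iota>)) (\<iota> ` A) (\<iota> (Sup A))"
  using assms by (auto simp: is_sup_def Sup_upper intro!: Sup_least)

lemma is_inf_ennreal_monoid:
  assumes "inj \<iota>"
  shows "is_inf (leq (ennreal_monoid \<iota>)) (\<iota> ` A) (\<iota> (Inf A))"
  using assms by (auto simp: is_inf_def is_sup_def Inf_lower intro!: Inf_greatest)

lemma ennreal_Sum_seq_restrict:
  assumes "inj \<iota>" "\<gamma> \<in> Field W"
  shows "ennreal_Sum \<iota> W (seq_restrict W (\<lambda>i. \<iota> (f i)) \<gamma>) = Some (\<iota> (\<Sum>\<^sub>\<infinity>i\<in>underS W \<gamma>. f i))"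
proof -
  have "seq_restrict W (\<lambda>i. \<iota> (f i)) \<gamma> \<in> seqs_lt W (range \<iota>)"
    using assms by (auto simp: seq_restrict_def seqs_lt_def)
  moreover have "(\<Sum>\<^sub>\<infinity>i\<in>underS W \<gamma>. inv_into UNIV \<iota> (restrict (\<lambda>i. \<iota> (f i)) (underS W \<gamma>) i)) = (\<Sum>\<^sub>\<infinity>i\<in>underS W \<gamma>. f i)"
    using assms by (intro infsum_cong) simp
  ultimately show ?thesis
    by (simp add: ennreal_Sum_def seq_restrict_def)
qed

text \<open>Continuity is the substantial axiom: finitely many indices below a limit are bounded
  below it, so every finite partial sum is already dominated by the sum over a proper initial
  segment.\<close>

lemma infinitary_sum_ennreal_Sum:
  assumes inj: "inj \<iota>" and W: "Well_order W"
  shows "infinitary_sum (ennreal_monoid \<iota>) W (ennreal_Sum \<iota> W)"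
proof -
  let ?S = "ennreal_monoid \<iota>" and ?Sum = "ennreal_Sum \<iota> W"
  interpret pto_monoid ?S
    by (rule pto_monoid_ennreal_monoid[OF inj])
  have dom: "s \<in> dom ?Sum \<longleftrightarrow> s \<in> seqs_lt W (range \<iota>)" for s
    by (simp add: ennreal_Sum_def dom_def)
  have transW: "trans W" and antisymW: "antisym W"
    using W by (auto simp: order_on_defs)
  show ?thesis
  proof
    show "Well_order W" by (rule W)
    show "dom ?Sum \<subseteq> seqs_lt W (carrier ?S)" "ran ?Sum \<subseteq> carrier ?S"
      by (auto simp: dom) (auto simp: ran_def ennreal_Sum_def split: if_splits)
    show "?Sum (\<alpha>, \<lambda>_. undefined) = Some \<one>\<^bsub>?S\<^esub>" if "\<alpha> \<in> Field W" "underS W \<alpha> = {}" for \<alpha>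
      using that by (simp add: ennreal_Sum_def seqs_lt_def)
    show "?Sum (\<alpha>, s) = Some (foldr (\<otimes>\<^bsub>?S\<^esub>) (map s ns) \<one>\<^bsub>?S\<^esub>)"
      if "(\<alpha>, s) \<in> dom ?Sum" "ns \<noteq> []" and ns: "set ns = underS W \<alpha>"
        "sorted_wrt (\<lambda>i j. i \<in> underS W j) ns" for \<alpha> s ns
    proof -
      \<comment> \<open>The relation \<open>i \<in> underS W j\<close> is strict, so an increasing
        list has no repetitions and its list sum is the sum over its set.\<close>
      have dist: "distinct ns"
        using ns(2) by (induction ns) (auto simp: underS_def)
      have "foldr (\<otimes>\<^bsub>?S\<^esub>) (map s ns) \<one>\<^bsub>?S\<^esub> = \<iota> (\<Sum>i\<leftarrow>ns. inv_into UNIV \<iota> (s i))" for ns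
        using inj by (induction ns) auto
      moreover have "(\<Sum>i\<leftarrow>ns. inv_into UNIV \<iota> (s i)) = (\<Sum>\<^sub>\<infinity>i\<in>underS W \<alpha>. inv_into UNIV \<iota> (s i))"
        using dist by (simp add: sum_list_distinct_conv_sum_set flip: ns(1))
      ultimately show ?thesis
        using that(1) by (simp add: dom ennreal_Sum_def)
    qed
    show "is_sup (leq ?S)
        {the (?Sum (seq_restrict W s \<gamma>)) | \<gamma>. \<gamma> \<in> underS W \<alpha> \<and> seq_restrict W s \<gamma> \<in> dom ?Sum}
        (the (?Sum (\<alpha>, s)))"
      if s: "(\<alpha>, s) \<in> dom ?Sum" and lim: "is_limit W \<alpha>" for \<alpha> s
    proof -
      define f where "f = (\<lambda>i. inv_into UNIV \<iota> (s i))"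
      have sub: "underS W \<gamma> \<subseteq> underS W \<alpha>" "\<gamma> \<in> Field W" if "\<gamma> \<in> underS W \<alpha>" for \<gamma>
        using that transD[OF transW] antisymD[OF antisymW] by (auto simp: underS_def Field_def)
      have restr: "seq_restrict W s \<gamma> = seq_restrict W (\<lambda>i. \<iota> (f i)) \<gamma>" if "\<gamma> \<in> underS W \<alpha>" for \<gamma>
        using s sub(1)[OF that] unfolding dom seqs_lt_def f_def seq_restrict_def
        by (auto simp: f_inv_into_f PiE_iff subset_iff intro!: restrict_ext)
      have val: "?Sum (seq_restrict W s \<gamma>) = Some (\<iota> (infsum f (underS W \<gamma>)))" if "\<gamma> \<in> underS W \<alpha>" for \<gamma>
        using ennreal_Sum_seq_restrict[OF inj sub(2)[OF that]] restr[OF that] by simp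
      have "{the (?Sum (seq_restrict W s \<gamma>)) | \<gamma>. \<gamma> \<in> underS W \<alpha> \<and> seq_restrict W s \<gamma> \<in> dom ?Sum}
          = \<iota> ` (\<lambda>\<gamma>. infsum f (underS W \<gamma>)) ` underS W \<alpha>"
        using val by (force simp: dom_def)
      moreover have "the (?Sum (\<alpha>, s)) = \<iota> (infsum f (underS W \<alpha>))"
        using s by (simp add: dom ennreal_Sum_def f_def)
      moreover have "infsum f (underS W \<alpha>) = (SUP \<gamma>\<in>underS W \<alpha>. infsum f (underS W \<gamma>))"
      proof (rule antisym)
        show "(SUP \<gamma>\<in>underS W \<alpha>. infsum f (underS W \<gamma>)) \<le> infsum f (underS W \<alpha>)"
          unfolding infsum_ennreal_eq_SUP
          by (intro SUP_least[OF SUP_subset_mono]) (use sub(1) in \<open>force+\<close>)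
        have "sum f F \<le> (SUP \<gamma>\<in>underS W \<alpha>. infsum f (underS W \<gamma>))"
          if F: "finite F" "F \<subseteq> underS W \<alpha>" for F
        proof -
          have "\<exists>\<gamma>\<in>underS W \<alpha>. F \<subseteq> underS W \<gamma>"
            using F
          proof (induction F)
            case empty
            then show ?case using lim by (auto simp: is_limit_def)
          next
            case (insert x F)
            then obtain \<gamma> where \<gamma>: "\<gamma> \<in> underS W \<alpha>" "F \<subseteq> underS W \<gamma>" by auto
            obtain \<delta> where \<delta>: "\<delta> \<in> underS W \<alpha>" "x \<in> underS W \<delta>"
              using insert.prems lim by (auto simp: is_limit_def)
            have "(\<gamma>, \<delta>) \<in> W \<or> (\<delta>, \<gamma>) \<in> W"
              using wo_rel.TOTALS[OF wo_rel.intro[OF W]] sub(2)[OF \<gamma>(1)] sub(2)[OF \<delta>(1)] by blast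
            then show ?case
            proof
              assume "(\<gamma>, \<delta>) \<in> W"
              then have "underS W \<gamma> \<subseteq> underS W \<delta>"
                using transD[OF transW] antisymD[OF antisymW] by (auto simp: underS_def)
              then show ?thesis using \<gamma> \<delta> by blast
            next
              assume "(\<delta>, \<gamma>) \<in> W"
              then have "underS W \<delta> \<subseteq> underS W \<gamma>"
                using transD[OF transW] antisymD[OF antisymW] by (auto simp: underS_def)
              then show ?thesis using \<gamma> \<delta> by blast
            qed
          qed
          then obtain \<gamma> where \<gamma>: "\<gamma> \<in> underS W \<alpha>" "F \<subseteq> underS W \<gamma>" by blast
          have "sum f F \<le> infsum f (underS W \<gamma>)"
            unfolding infsum_ennreal_eq_SUP using F \<gamma> by (intro SUP_upper) auto
          also have "\<dots> \<le> (SUP \<gamma>\<in>underS W \<alpha>. infsum f (underS W \<gamma>))"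
            using \<gamma>(1) by (rule SUP_upper)
          finally show ?thesis .
        qed
        then show "infsum f (underS W \<alpha>) \<le> (SUP \<gamma>\<in>underS W \<alpha>. infsum f (underS W \<gamma>))"
          by (subst infsum_ennreal_eq_SUP) (auto intro: SUP_least)
      qed
      ultimately show ?thesis
        using is_sup_ennreal_monoid[OF inj] by simp
    qed
  qed
qed

section \<open>The embedding of the unit interval\<close>

text \<open>Otherwise some position \<open>a\<close> of \<open>kappa\<close> has order type
  \<omega>, and the sequences of length \<open>a\<close> in the letters \<open>p\<close> and
  \<open>q\<close> already code all subsets of the natural numbers.\<close>

lemma natLeq_ordIso_if_seqs_lt_ordLess:
  fixes kappa :: "'k rel" and A :: "'a set"
  assumes kappa: "Cinfinite kappa" and A: "p \<in> A" "q \<in> A" "p \<noteq> q"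
    and less: "|seqs_lt kappa A| <o |UNIV :: nat set set|"
  shows "natLeq =o kappa"
proof (rule ccontr)
  assume "\<not> natLeq =o kappa"
  then have "natLeq <o kappa"
    using natLeq_ordLeq_cinfinite[OF kappa] ordLeq_iff_ordLess_or_ordIso by blast
  then obtain a where a: "a \<in> Field kappa" "natLeq =o ord_at kappa a"
    using ordLess_iff_ordIso_Restr[OF card_order_on_well_order_on[OF conjunct2[OF kappa]] natLeq_Well_order]
    by blast
  have "Field (ord_at kappa a) \<subseteq> underS kappa a"
    by (auto simp: Field_def)
  moreover have "infinite (Field (ord_at kappa a))"
    using a(2) by (metis Field_natLeq card_of_cong card_of_ordIso_finite infinite_UNIV_nat)
  ultimately obtain b :: "nat \<Rightarrow> 'k" where b: "inj b" "range b \<subseteq> underS kappa a"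
    using infinite_countable_subset[of "underS kappa a"] finite_subset by metis
  define h where "h T = (a, \<lambda>i\<in>underS kappa a. if i \<in> b ` T then p else q)" for T
  have "inj h"
  proof (rule injI)
    fix T T' assume "h T = h T'"
    then have eq: "(\<lambda>i\<in>underS kappa a. if i \<in> b ` T then p else q)
        = (\<lambda>i\<in>underS kappa a. if i \<in> b ` T' then p else q)"
      by (simp add: h_def)
    have "n \<in> T \<longleftrightarrow> n \<in> T'" for n
      using fun_cong[OF eq, of "b n"] b A(3) by (auto simp: inj_image_mem_iff range_subsetD split: if_splits)
    then show "T = T'"
      by blast
  qed
  moreover have "h ` UNIV \<subseteq> seqs_lt kappa A"
    using a(1) A by (auto simp: h_def seqs_lt_def)
  ultimately have "|UNIV :: nat set set| \<le>o |seqs_lt kappa A|"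
    using card_of_ordLeq by blast
  then show False
    using less not_ordLess_ordLeq by blast
qed

text \<open>The situation once \<open>kappa\<close> is known to be \<omega>: \<open>c\<close> lists
  the positions in increasing order, and \<open>range e\<close> is the countable set of letters that
  the embedding uses.\<close>

locale dyadic_embedding =
  fixes kappa :: "'k rel" and lam :: "'l rel" and c :: "nat \<Rightarrow> 'k" and e :: "nat \<Rightarrow> 'l"
  assumes well_order_kappa: "Well_order kappa"
    and bij_c: "bij_betw c UNIV (Field kappa)"
    and underS_c: "underS kappa (c n) = c ` {..<n}"
    and inj_e: "inj e"
    and e_in_Field: "e n \<in> Field lam"
begin

abbreviation "X \<equiv> bounded_topology kappa lam"

lemma c_in_Field [simp]: "c n \<in> Field kappa"
  using bij_c by (auto simp: bij_betw_def)

lemma inj_c: "inj c"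
  using bij_c by (auto simp: bij_betw_def)

lemma topspace_X: "topspace X = seqs kappa lam"
  using topspace_bounded_topology[OF well_order_kappa] c_in_Field by blast

lemma openin_cone: "s \<in> seqs_lt kappa (Field lam) \<Longrightarrow> openin X (Defs.cone kappa lam s)"
  unfolding bounded_topology_def by (rule topology_generated_by_Basis) auto

section \<open>Basic neighbourhoods given by the first n letters\<close>

definition nbhd :: "('k \<Rightarrow> 'l) \<Rightarrow> nat \<Rightarrow> ('k \<Rightarrow> 'l) set" where
  "nbhd x n = Defs.cone kappa lam (seq_restrict kappa x (c n))"

lemma mem_nbhd_iff: "y \<in> nbhd x n \<longleftrightarrow> y \<in> seqs kappa lam \<and> (\<forall>i<n. y (c i) = x (c i))"
  unfolding nbhd_def Defs.cone_def seq_restrict_def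
  by (auto simp: underS_c fun_eq_iff restrict_def)

lemma openin_nbhd:
  assumes "x \<in> seqs kappa lam"
  shows "openin X (nbhd x n)"
  unfolding nbhd_def using assms
  by (intro openin_cone) (auto simp: seqs_lt_def seqs_def seq_restrict_def underS_c)

text \<open>The neighbourhoods of a point are nested, so the larger of two indices serves for an
  intersection.\<close>

lemma nbhd_subset_open:
  assumes "openin X U" and "x \<in> U"
  obtains n where "nbhd x n \<subseteq> U"
proof -
  have "generate_topology_on (Defs.cone kappa lam ` seqs_lt kappa (Field lam)) U"
    using assms(1) unfolding bounded_topology_def by (simp add: openin_topology_generated_by_iff)
  then have "\<exists>n. nbhd x n \<subseteq> U"
    using assms(2)
  proof (induction arbitrary: x)
    case (Int U V)
    then obtain m n where "nbhd x m \<subseteq> U" "nbhd x n \<subseteq> V" by blast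
    then have "nbhd x (max m n) \<subseteq> U \<inter> V"
      by (auto simp: mem_nbhd_iff subset_iff)
    then show ?case ..
  next
    case (Basis U)
    then obtain s where s: "s \<in> seqs_lt kappa (Field lam)" "U = Defs.cone kappa lam s" by blast
    then have "s = seq_restrict kappa x (fst s)" "fst s \<in> Field kappa"
      using Basis.prems by (auto simp: Defs.cone_def seqs_lt_def)
    moreover from this obtain n where "fst s = c n"
      using bij_c by (auto simp: bij_betw_def)
    ultimately show ?case
      using s(2) by (metis nbhd_def order_refl)
  qed blast+
  then show thesis using that by blast
qed

text \<open>
  The letter at place \<open>n\<close> encodes the whole dyadic approximation \<open>\<lfloor>2 ^ n * t\<rfloor>\<close> and not a single digit, so
  that it determines all earlier letters.
\<close>

definition enc :: "real \<Rightarrow> 'k \<Rightarrow> 'l" where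
  "enc t = (\<lambda>k\<in>Field kappa. e (nat \<lfloor>2 ^ inv_into UNIV c k * t\<rfloor>))"

lemma enc_c [simp]: "enc t (c n) = e (nat \<lfloor>2 ^ n * t\<rfloor>)"
  by (simp add: enc_def inj_c)

lemma enc_in_seqs [simp]: "enc t \<in> seqs kappa lam"
  by (auto simp: enc_def seqs_def e_in_Field)

section \<open>Dyadic intervals and pullbacks of open sets\<close>

definition dyadic :: "nat \<Rightarrow> int \<Rightarrow> real set" where
  "dyadic n m = {t \<in> {0..<1}. \<lfloor>2 ^ n * t\<rfloor> = m}"

lemma dyadic_sets [measurable]: "dyadic n m \<in> sets borel"
  unfolding dyadic_def by measurable

lemma emeasure_dyadic_le: "emeasure lborel (dyadic n m) \<le> ennreal (1 / 2 ^ n)"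
proof -
  have "dyadic n m \<subseteq> {of_int m / 2 ^ n .. of_int m / 2 ^ n + 1 / 2 ^ n}"
    by (auto simp: dyadic_def field_simps) linarith+
  then have "emeasure lborel (dyadic n m) \<le> emeasure lborel {of_int m / 2 ^ n .. of_int m / 2 ^ n + 1 / (2 ^ n :: real)}"
    by (intro emeasure_mono) auto
  also have "\<dots> = ennreal (1 / 2 ^ n)"
    by (simp add: emeasure_lborel_Icc_eq)
  finally show ?thesis .
qed

text \<open>A coarser approximation is an integer quotient of a finer one. Hence all points of an
  interval of level n share the letters of \<open>enc\<close> up to place n.\<close>

lemma dyadic_imp_floor_eq:
  assumes "s \<in> dyadic n m" "t \<in> dyadic n m" "i \<le> n"
  shows "\<lfloor>2 ^ i * s\<rfloor> = \<lfloor>2 ^ i * t\<rfloor>"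
proof -
  have "\<lfloor>2 ^ i * u\<rfloor> = \<lfloor>2 ^ n * u\<rfloor> div 2 ^ (n - i)" for u :: real
  proof -
    have "2 ^ n * u / real_of_int (2 ^ (n - i)) = 2 ^ i * u"
      using assms(3) by (simp add: field_simps flip: power_add)
    then show ?thesis
      using floor_divide_real_eq_div[of "2 ^ (n - i)" "2 ^ n * u"] by simp
  qed
  then show ?thesis
    using assms by (simp add: dyadic_def)
qed

text \<open>Equal letters at every place force |s - t| < 1 / 2 ^ n for all n.\<close>

lemma inj_on_enc: "inj_on enc {0..<1}"
proof (rule inj_onI, rule ccontr)
  fix s t :: real assume st: "s \<in> {0..<1}" "t \<in> {0..<1}" "enc s = enc t" "s \<noteq> t"
  have "\<lfloor>2 ^ n * s\<rfloor> = \<lfloor>2 ^ n * t\<rfloor>" for n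
  proof -
    have "nat \<lfloor>2 ^ n * s\<rfloor> = nat \<lfloor>2 ^ n * t\<rfloor>"
      using st(3) inj_e enc_c by (metis injD)
    then show ?thesis
      using st(1,2) by (simp add: nat_eq_iff2)
  qed
  then have le: "\<bar>2 ^ n * s - 2 ^ n * t\<bar> < 1" for n
    using floor_correct[of "2 ^ n * s"] floor_correct[of "2 ^ n * t"] by (simp add: abs_less_iff) linarith
  obtain n where "1 / \<bar>s - t\<bar> < 2 ^ n"
    using real_arch_pow[of 2] by auto
  then have "1 < 2 ^ n * \<bar>s - t\<bar>"
    using st(4) by (simp add: field_simps)
  then show False
    using le[of n] by (simp add: abs_mult flip: right_diff_distrib)
qed

text \<open>An open \<open>U\<close> will receive the value
  \<open>emeasure lborel (preim U)\<close>, its mass under the image of Lebesgue measure on [0,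
  1).\<close>

definition preim :: "('k \<Rightarrow> 'l) set \<Rightarrow> real set" where
  "preim U = {t \<in> {0..<1}. enc t \<in> U}"

text \<open>Some neighbourhood of \<open>enc t\<close> inside \<open>U\<close> depends on the first
  n letters only, and these are constant on the interval of level n around \<open>t\<close>.\<close>

lemma dyadic_subset_preim:
  assumes "openin X U" and "t \<in> preim U"
  obtains n where "dyadic n \<lfloor>2 ^ n * t\<rfloor> \<subseteq> preim U"
proof -
  have t: "enc t \<in> U" "t \<in> {0..<1}"
    using assms(2) by (auto simp: preim_def)
  obtain n where n: "nbhd (enc t) n \<subseteq> U"
    using nbhd_subset_open[OF assms(1) t(1)] by blast
  have "s \<in> preim U" if s: "s \<in> dyadic n \<lfloor>2 ^ n * t\<rfloor>" for s
  proof -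
    have "t \<in> dyadic n \<lfloor>2 ^ n * t\<rfloor>"
      using t(2) by (simp add: dyadic_def)
    then have "enc s \<in> nbhd (enc t) n"
      using dyadic_imp_floor_eq[OF s] by (simp add: mem_nbhd_iff)
    then show ?thesis
      using n s by (auto simp: preim_def dyadic_def)
  qed
  then show thesis using that by blast
qed

text \<open>There are only countably many dyadic intervals, so the preimage is Borel however many
  cones make up \<open>U\<close>.\<close>

lemma preim_eq_Union_dyadic:
  assumes "openin X U"
  shows "preim U = (\<Union>(n, m)\<in>{(n, m). dyadic n m \<subseteq> preim U}. dyadic n m)"
proof -
  have "\<exists>n m. dyadic n m \<subseteq> preim U \<and> t \<in> dyadic n m" if t: "t \<in> preim U" for t
  proof -
    obtain n where "dyadic n \<lfloor>2 ^ n * t\<rfloor> \<subseteq> preim U"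
      using dyadic_subset_preim[OF assms t] .
    moreover have "t \<in> dyadic n \<lfloor>2 ^ n * t\<rfloor>"
      using t by (simp add: dyadic_def preim_def)
    ultimately show ?thesis by blast
  qed
  then show ?thesis by blast
qed

lemma preim_sets:
  assumes "openin X U"
  shows "preim U \<in> sets borel"
  by (subst preim_eq_Union_dyadic[OF assms]) (auto intro!: sets.countable_UN')

text \<open>The first n + 1 letters include the one at place n, which fixes the dyadic interval of
  level n; hence the shift by one.\<close>

lemma emeasure_preim_nbhd: "emeasure lborel (preim (nbhd x (Suc n))) \<le> ennreal (1 / 2 ^ n)"
proof (cases "preim (nbhd x (Suc n)) = {}")
  case False
  then obtain t where t: "t \<in> preim (nbhd x (Suc n))" by blast
  have "preim (nbhd x (Suc n)) \<subseteq> dyadic n \<lfloor>2 ^ n * t\<rfloor>"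
  proof
    fix s assume s: "s \<in> preim (nbhd x (Suc n))"
    then have "e (nat \<lfloor>2 ^ n * s\<rfloor>) = e (nat \<lfloor>2 ^ n * t\<rfloor>)"
      using t by (auto simp: preim_def mem_nbhd_iff)
    then have "nat \<lfloor>2 ^ n * s\<rfloor> = nat \<lfloor>2 ^ n * t\<rfloor>"
      using inj_e by (simp add: inj_eq)
    then show "s \<in> dyadic n \<lfloor>2 ^ n * t\<rfloor>"
      using s t by (simp add: preim_def dyadic_def nat_eq_iff2)
  qed
  then show ?thesis
    by (intro order_trans[OF emeasure_mono emeasure_dyadic_le]) simp_all
qed simp

text \<open>A countable chain condition: each non-empty preimage contains a non-empty dyadic
  interval, and disjointness makes the choice of one injective.\<close>

lemma countable_nonempty_preims:
  assumes U: "\<And>i. i \<in> I \<Longrightarrow> openin X (U i)"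
    and disj: "disjoint_family_on (\<lambda>i. preim (U i)) I"
  shows "countable {i \<in> I. preim (U i) \<noteq> {}}"
proof -
  let ?J = "{i \<in> I. preim (U i) \<noteq> {}}"
  have "\<exists>nm. dyadic (fst nm) (snd nm) \<noteq> {} \<and> dyadic (fst nm) (snd nm) \<subseteq> preim (U i)" if i: "i \<in> ?J" for i
  proof -
    obtain t where t: "t \<in> preim (U i)" using i by blast
    obtain n where "dyadic n \<lfloor>2 ^ n * t\<rfloor> \<subseteq> preim (U i)"
      using dyadic_subset_preim[OF U t] i by blast
    moreover have "t \<in> dyadic n \<lfloor>2 ^ n * t\<rfloor>"
      using t by (simp add: dyadic_def preim_def)
    ultimately show ?thesis by force
  qed
  then have "\<exists>h. \<forall>i\<in>?J. dyadic (fst (h i)) (snd (h i)) \<noteq> {} \<and> dyadic (fst (h i)) (snd (h i)) \<subseteq> preim (U i)"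
    by (intro bchoice ballI)
  then obtain h where h: "\<And>i. i \<in> ?J \<Longrightarrow> dyadic (fst (h i)) (snd (h i)) \<noteq> {}"
    "\<And>i. i \<in> ?J \<Longrightarrow> dyadic (fst (h i)) (snd (h i)) \<subseteq> preim (U i)"
    by blast
  have "inj_on h ?J"
  proof (rule inj_onI, rule ccontr)
    fix i j assume ij: "i \<in> ?J" "j \<in> ?J" "h i = h j" "i \<noteq> j"
    have "preim (U i) \<inter> preim (U j) = {}"
      using disj ij by (auto simp: disjoint_family_on_def)
    then show False
      using h[OF ij(1)] h[OF ij(2)] ij(3) by auto
  qed
  then show ?thesis
    by (rule countableI')
qed

end

section \<open>The measure\<close>

locale dyadic_measure = dyadic_embedding +
  assumes Cinfinite_lam: "Cinfinite lam"
    and lam_ordLess: "lam <o |UNIV :: nat set set|"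
begin

text \<open>The exceptional part \<open>A - U\<close> lets the singletons in, with
  \<open>U = {}\<close>, as continuity of the measure demands.\<close>

definition \<MM> :: "('a \<Rightarrow> 'b) set set" where
  "\<MM> = {A. A \<subseteq> topspace X \<and> (\<exists>U. openin X U \<and> U \<subseteq> A \<and> |A - U| \<le>o lam)}"

text \<open>The infimum is attained by any open part of \<open>A\<close>, which spares a choice among them.\<close>

definition \<nu> :: "('a \<Rightarrow> 'b) set \<Rightarrow> ennreal" where
  "\<nu> A = (INF U\<in>{U. openin X U \<and> |A - U| \<le>o lam}. emeasure lborel (preim U))"

section \<open>Well-definedness and additivity of \<nu>\<close>

lemma card_of_ordLeq_lam_mono: "|B| \<le>o lam \<Longrightarrow> A \<subseteq> B \<Longrightarrow> |A| \<le>o lam"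
  using card_of_mono1 ordLeq_transitive by blast

lemma card_of_UNION_ordLeq_lam: "|I| \<le>o lam \<Longrightarrow> (\<And>i. i \<in> I \<Longrightarrow> |B i| \<le>o lam) \<Longrightarrow> |\<Union>i\<in>I. B i| \<le>o lam"
  using card_of_UNION_ordLeq_infinite_Field Cinfinite_lam unfolding cinfinite_def by blast

text \<open>The Borel set \<open>preim U - preim V\<close> injects into \<open>U - V\<close> by
  \<open>enc\<close>, so it has fewer than continuum many points and is null.\<close>

lemma emeasure_preim_le:
  assumes U: "openin X U" and V: "openin X V" and small: "|U - V| \<le>o lam"
  shows "emeasure lborel (preim U) \<le> emeasure lborel (preim V)"
proof -
  have sets [measurable]: "preim U \<in> sets borel" "preim V \<in> sets borel"
    using U V by (auto intro: preim_sets)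
  have "enc ` (preim U - preim V) \<subseteq> U - V" "inj_on enc (preim U - preim V)"
    by (auto simp: preim_def intro: inj_on_subset[OF inj_on_enc])
  then have "|preim U - preim V| \<le>o |U - V|"
    using card_of_ordLeq by blast
  then have "|preim U - preim V| <o |UNIV :: nat set set|"
    using small lam_ordLess ordLeq_transitive ordLeq_ordLess_trans by blast
  then have "emeasure lborel (preim U - preim V) = 0"
    using positive_measure_imp_continuum[of "preim U - preim V"] sets not_ordLess_ordLeq by blast
  then have "emeasure lborel (preim V \<union> (preim U - preim V)) \<le> emeasure lborel (preim V)"
    using emeasure_subadditive[of "preim V" lborel "preim U - preim V"] sets by simp
  moreover have "emeasure lborel (preim U) \<le> emeasure lborel (preim V \<union> (preim U - preim V))"
    using sets by (intro emeasure_mono) auto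
  ultimately show ?thesis by simp
qed

text \<open>Every competitor \<open>V\<close> in the infimum misses at most \<open>lam\<close>
  points of \<open>A\<close>, hence of \<open>U\<close>, so \<open>emeasure_preim_le\<close> bounds
  it from below.\<close>

lemma \<nu>_eq:
  assumes "openin X U" "U \<subseteq> A" "|A - U| \<le>o lam"
  shows "\<nu> A = emeasure lborel (preim U)"
proof (rule antisym)
  show "\<nu> A \<le> emeasure lborel (preim U)"
    unfolding \<nu>_def using assms by (intro INF_lower) simp
  show "emeasure lborel (preim U) \<le> \<nu> A"
    unfolding \<nu>_def
  proof (rule INF_greatest)
    fix V assume "V \<in> {V. openin X V \<and> |A - V| \<le>o lam}"
    then have V: "openin X V" "|A - V| \<le>o lam" by auto
    show "emeasure lborel (preim U) \<le> emeasure lborel (preim V)"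
      using emeasure_preim_le[OF assms(1) V(1)] card_of_ordLeq_lam_mono[OF V(2)] assms(2) by blast
  qed
qed

text \<open>Competitors in the infimum need not be subsets of the set measured, so each competitor
  for \<open>B\<close> is one for \<open>A\<close>.\<close>

lemma \<nu>_mono: "A \<subseteq> B \<Longrightarrow> \<nu> A \<le> \<nu> B"
  unfolding \<nu>_def by (intro INF_superset_mono) (auto intro: card_of_ordLeq_lam_mono)

lemma finite_ordLeq_lam: "finite A \<Longrightarrow> |A| \<le>o lam"
  using Cinfinite_lam
  by (intro ordLess_imp_ordLeq finite_ordLess_infinite)
    (auto simp: cinfinite_def Field_card_of card_of_well_order_on intro: card_of_Well_order card_order_on_well_order_on)

lemma \<nu>_open: "openin X U \<Longrightarrow> \<nu> U = emeasure lborel (preim U)"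
  by (intro \<nu>_eq) (simp_all add: finite_ordLeq_lam)

lemma open_in_\<MM>: "openin X U \<Longrightarrow> U \<in> \<MM>"
  using openin_subset[of X U] by (auto simp: \<MM>_def finite_ordLeq_lam intro!: exI[of _ U])

lemma \<MM>E:
  assumes "A \<in> \<MM>"
  obtains U where "openin X U" "U \<subseteq> A" "|A - U| \<le>o lam" "\<nu> A = emeasure lborel (preim U)"
  using assms \<nu>_eq unfolding \<MM>_def by blast

text \<open>At most \<open>lam\<close> exceptional parts of size at most \<open>lam\<close> unite to
  one of size at most \<open>lam\<close>. For disjoint sets the chosen open parts are disjoint too,
  and only countably many of them have non-empty preimage.\<close>

lemma UNION_\<MM>:
  assumes I: "|I| \<le>o lam" and A: "\<And>i. i \<in> I \<Longrightarrow> A i \<in> \<MM>"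
  shows "(\<Union>i\<in>I. A i) \<in> \<MM>"
    and "disjoint_family_on A I \<Longrightarrow> \<nu> (\<Union>i\<in>I. A i) = (\<Sum>\<^sub>\<infinity>i\<in>I. \<nu> (A i))"
proof -
  have "\<exists>U. \<forall>i\<in>I. openin X (U i) \<and> U i \<subseteq> A i \<and> |A i - U i| \<le>o lam \<and> \<nu> (A i) = emeasure lborel (preim (U i))"
    using \<MM>E[OF A] by (intro bchoice ballI) blast
  then obtain U where U: "\<And>i. i \<in> I \<Longrightarrow> openin X (U i)" "\<And>i. i \<in> I \<Longrightarrow> U i \<subseteq> A i"
    and diff: "\<And>i. i \<in> I \<Longrightarrow> |A i - U i| \<le>o lam"
    and val: "\<And>i. i \<in> I \<Longrightarrow> \<nu> (A i) = emeasure lborel (preim (U i))"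
    by blast
  have op: "openin X (\<Union>i\<in>I. U i)" using U(1) by blast
  have sub: "(\<Union>i\<in>I. U i) \<subseteq> (\<Union>i\<in>I. A i)" using U(2) by blast
  have "|\<Union>i\<in>I. A i - U i| \<le>o lam"
    using I diff by (rule card_of_UNION_ordLeq_lam)
  then have small: "|(\<Union>i\<in>I. A i) - (\<Union>i\<in>I. U i)| \<le>o lam"
    by (rule card_of_ordLeq_lam_mono) blast
  have "(\<Union>i\<in>I. A i) \<subseteq> topspace X"
    using A by (auto simp: \<MM>_def)
  then show "(\<Union>i\<in>I. A i) \<in> \<MM>"
    using op sub small unfolding \<MM>_def by blast
  assume "disjoint_family_on A I"
  then have disj: "disjoint_family_on (\<lambda>i. preim (U i)) I"
    using U(2) by (fastforce simp: disjoint_family_on_def preim_def)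
  have "\<nu> (\<Union>i\<in>I. A i) = emeasure lborel (preim (\<Union>i\<in>I. U i))"
    by (rule \<nu>_eq[OF op sub small])
  also have "preim (\<Union>i\<in>I. U i) = (\<Union>i\<in>I. preim (U i))"
    by (auto simp: preim_def)
  also have "emeasure lborel \<dots> = (\<Sum>\<^sub>\<infinity>i\<in>I. emeasure lborel (preim (U i)))"
    using disj countable_nonempty_preims[OF U(1) disj] preim_sets[OF U(1)]
    by (intro infsum_emeasure) auto
  also have "\<dots> = (\<Sum>\<^sub>\<infinity>i\<in>I. \<nu> (A i))"
    by (rule infsum_cong) (simp add: val)
  finally show "\<nu> (\<Union>i\<in>I. A i) = (\<Sum>\<^sub>\<infinity>i\<in>I. \<nu> (A i))" .
qed

section \<open>Points, total mass and local bases\<close>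

lemma singleton_in_\<MM>:
  assumes "x \<in> topspace X"
  shows "{x} \<in> \<MM>" and "\<nu> {x} = 0"
proof -
  have small: "|{x} - {}| \<le>o lam"
    by (simp add: finite_ordLeq_lam)
  then show "{x} \<in> \<MM>"
    using assms unfolding \<MM>_def by (intro CollectI conjI exI[of _ "{}"]) auto
  show "\<nu> {x} = 0"
    using \<nu>_eq[OF openin_empty empty_subsetI small] by (simp add: preim_def)
qed

lemma \<nu>_topspace: "\<nu> (topspace X) = 1"
proof -
  have "preim (topspace X) = {0..<1}"
    by (auto simp: preim_def topspace_X)
  then show ?thesis
    by (simp add: \<nu>_open)
qed

text \<open>A local base has a member inside each \<open>nbhd x (Suc n)\<close>, whose value is at
  most 1 / 2 ^ n.\<close>

lemma INF_local_base:
  assumes x: "x \<in> topspace X" and base: "is_local_base X x \<B>"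
  shows "(INF A\<in>\<B>. \<nu> A) = 0"
proof -
  have "(INF A\<in>\<B>. \<nu> A) \<le> ennreal (1 / 2 ^ n)" for n
  proof -
    have n: "openin X (nbhd x (Suc n))" "x \<in> nbhd x (Suc n)"
      using x by (auto simp: topspace_X openin_nbhd mem_nbhd_iff)
    then obtain V where V: "V \<in> \<B>" "V \<subseteq> nbhd x (Suc n)"
      using base unfolding is_local_base_def by blast
    have "(INF A\<in>\<B>. \<nu> A) \<le> \<nu> V"
      using V(1) by (rule INF_lower)
    also have "\<dots> \<le> \<nu> (nbhd x (Suc n))"
      using V(2) by (rule \<nu>_mono)
    also have "\<dots> \<le> ennreal (1 / 2 ^ n)"
      using \<nu>_open[OF n(1)] emeasure_preim_nbhd by simp
    finally show ?thesis .
  qed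
  moreover have "(\<lambda>n. ennreal (1 / 2 ^ n)) \<longlonglongrightarrow> ennreal 0"
    using LIMSEQ_divide_realpow_zero[of 2 1] by (intro tendsto_ennrealI) simp
  ultimately have "(INF A\<in>\<B>. \<nu> A) \<le> ennreal 0"
    by (intro LIMSEQ_le_const) auto
  then show ?thesis by simp
qed

text \<open>The carrier of the monoid has to consist of sets of points.\<close>

definition \<iota> :: "ennreal \<Rightarrow> ('a \<Rightarrow> 'b) set" where
  "\<iota> x = (if x = \<infinity> then {} else {enc (enn2real x / (1 + enn2real x))})"

text \<open>The map x \<mapsto> x / (1 + x) sends [0, \<infinity>) injectively into [0, 1), where
  \<open>enc\<close> is injective; \<infinity> gets the only value that is not a singleton.\<close>

lemma inj_\<iota>: "inj \<iota>"
proof (rule injI)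
  fix x y assume eq: "\<iota> x = \<iota> y"
  show "x = y"
  proof (cases "x = \<infinity> \<or> y = \<infinity>")
    case True
    then show ?thesis using eq by (auto simp: \<iota>_def split: if_splits)
  next
    case False
    have r: "enn2real z / (1 + enn2real z) \<in> {0..<1}" for z
    proof -
      have "0 \<le> enn2real z" by simp
      then have "enn2real z / (1 + enn2real z) < 1" by (subst divide_less_eq_1_pos) linarith+
      then show ?thesis by simp
    qed
    have "enn2real x / (1 + enn2real x) = enn2real y / (1 + enn2real y)"
      using eq False inj_onD[OF inj_on_enc _ r r] by (auto simp: \<iota>_def)
    moreover have "1 + enn2real x > 0" "1 + enn2real y > 0"
      using enn2real_nonneg[of x] enn2real_nonneg[of y] by linarith+
    ultimately have "enn2real x = enn2real y"
      by (simp add: field_simps)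
    then have "ennreal (enn2real x) = ennreal (enn2real y)"
      by simp
    then show ?thesis
      using False by (simp add: ennreal_enn2real_if)
  qed
qed

definition \<mu> :: "('a \<Rightarrow> 'b) set \<Rightarrow> ('a \<Rightarrow> 'b) set option" where
  "\<mu> A = (if A \<in> \<MM> then Some (\<iota> (\<nu> A)) else None)"

lemma weak_measure_space:
  assumes W: "Well_order W"
  shows "weak_measure_space (ennreal_monoid \<iota>) W (ennreal_Sum \<iota> W) lam X \<MM> \<mu>"
proof -
  interpret infinitary_sum "ennreal_monoid \<iota>" W "ennreal_Sum \<iota> W"
    by (rule infinitary_sum_ennreal_Sum[OF inj_\<iota> W])
  \<comment> \<open>An ordinal below the successor of \<open>lam\<close> has at most
    \<open>lam\<close> elements, which is the form that \<open>UNION_\<MM>\<close> requires.\<close>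
  have card_underS: "|underS W \<gamma>| \<le>o lam" if "\<gamma> \<in> Field W" "ord_at W \<gamma> <o cardSuc lam" for \<gamma>
  proof -
    have "Field (ord_at W \<gamma>) = underS W \<gamma>"
      using W Refl_Field_Restr2[of W "underS W \<gamma>"]
      by (simp add: order_on_defs Order_Relation.underS_Field)
    moreover have "Well_order (ord_at W \<gamma>)"
      using W by (rule Well_order_Restr)
    ultimately have "|underS W \<gamma>| \<le>o ord_at W \<gamma>"
      using card_of_least by metis
    then have "|underS W \<gamma>| <o cardSuc lam"
      using that(2) by (rule ordLeq_ordLess_trans)
    then show ?thesis
      using Cinfinite_lam cardSuc_ordLeq_ordLess[OF _ card_of_Card_order] by blast
  qed
  show ?thesis
  proof
    show "\<MM> \<subseteq> Pow (topspace X)" by (auto simp: \<MM>_def)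
    show "\<Union>\<A> \<in> \<MM>" if "\<A> \<subseteq> \<MM>" "|\<A>| \<le>o lam" for \<A>
      using UNION_\<MM>(1)[of \<A> id] that by auto
    show "U \<in> \<MM>" if "openin X U" for U
      using that by (rule open_in_\<MM>)
    show "dom \<mu> \<subseteq> Pow (topspace X)" "ran \<mu> \<subseteq> carrier (ennreal_monoid \<iota>)" "\<MM> \<subseteq> dom \<mu>"
      by (auto simp: \<mu>_def \<MM>_def dom_def ran_def split: if_splits)
    show "\<mu> {} = Some \<one>\<^bsub>ennreal_monoid \<iota>\<^esub>"
      using open_in_\<MM>[of "{}"] \<nu>_open[of "{}"] by (simp add: \<mu>_def preim_def)
    have "the (\<mu> (topspace X)) = \<iota> 1"
      using open_in_\<MM>[of "topspace X"] by (simp add: \<mu>_def \<nu>_topspace)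
    then show "(\<one>\<^bsub>ennreal_monoid \<iota>\<^esub>, the (\<mu> (topspace X))) \<in> leq (ennreal_monoid \<iota>)"
      "the (\<mu> (topspace X)) \<noteq> \<one>\<^bsub>ennreal_monoid \<iota>\<^esub>"
      using inj_\<iota> by (simp_all add: inj_eq)
    show "(the (\<mu> A), the (\<mu> B)) \<in> leq (ennreal_monoid \<iota>)" if "A \<in> \<MM>" "B \<in> \<MM>" "A \<subseteq> B" for A B
      using that inj_\<iota> by (simp add: \<mu>_def \<nu>_mono)
    show "seq_restrict W (\<lambda>i. the (\<mu> (F i))) \<gamma> \<in> dom (ennreal_Sum \<iota> W) \<and>
        \<mu> (\<Union>i\<in>underS W \<gamma>. F i) = ennreal_Sum \<iota> W (seq_restrict W (\<lambda>i. the (\<mu> (F i))) \<gamma>)"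
      if \<gamma>: "\<gamma> \<in> Field W" "ord_at W \<gamma> <o cardSuc lam" and F: "\<And>i. i \<in> underS W \<gamma> \<Longrightarrow> F i \<in> \<MM>"
        and disj: "\<And>i j. \<lbrakk>i \<in> underS W \<gamma>; j \<in> underS W \<gamma>; i \<noteq> j\<rbrakk> \<Longrightarrow> F i \<inter> F j = {}" for \<gamma> F
    proof -
      have "seq_restrict W (\<lambda>i. the (\<mu> (F i))) \<gamma> = seq_restrict W (\<lambda>i. \<iota> (\<nu> (F i))) \<gamma>"
        using F by (auto simp: seq_restrict_def \<mu>_def intro!: restrict_ext)
      moreover have "\<nu> (\<Union>i\<in>underS W \<gamma>. F i) = (\<Sum>\<^sub>\<infinity>i\<in>underS W \<gamma>. \<nu> (F i))"
        using disj by (intro UNION_\<MM>(2) card_underS[OF \<gamma>] F) (auto simp: disjoint_family_on_def)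
      ultimately show ?thesis
        using UNION_\<MM>(1)[OF card_underS[OF \<gamma>], of F] F
        by (auto simp: ennreal_Sum_seq_restrict[OF inj_\<iota> \<gamma>(1)] \<mu>_def)
    qed
    show "is_inf (leq (ennreal_monoid \<iota>)) ((\<lambda>i. the (\<mu> (F i))) ` underS W \<gamma>) (the (\<mu> {x}))"
      if x: "x \<in> topspace X" and base: "is_local_base X x (F ` underS W \<gamma>)" for x \<gamma> F
    proof -
      have "(\<lambda>i. the (\<mu> (F i))) ` underS W \<gamma> = \<iota> ` \<nu> ` F ` underS W \<gamma>"
        using base open_in_\<MM> unfolding is_local_base_def image_image
        by (intro image_cong) (auto simp: \<mu>_def)
      moreover have "the (\<mu> {x}) = \<iota> (INF A\<in>F ` underS W \<gamma>. \<nu> A)"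
        using singleton_in_\<MM>[OF x] INF_local_base[OF x base] by (simp add: \<mu>_def)
      ultimately show ?thesis
        using is_inf_ennreal_monoid[OF inj_\<iota>] by simp
    qed
  qed
qed

lemma continuous_measure: "continuous_measure (ennreal_monoid \<iota>) X \<MM> \<mu>"
  by (simp add: continuous_measure_def \<mu>_def singleton_in_\<MM>)

text \<open>Points of the support use only the countably many letters in \<open>range e\<close>, so
  the traces of cones over finite sequences of such letters form a countable base. Here
  \<open>cardSuc natLeq\<close> is \<omega>1.\<close>

lemma Dirac: "Dirac (cardSuc natLeq) (ennreal_monoid \<iota>) X \<mu>"
proof -
  define Y where "Y = measure_support (ennreal_monoid \<iota>) X \<mu>"
  define \<B> where "\<B> = (\<lambda>s. Defs.cone kappa lam s \<inter> Y) ` seqs_lt kappa (range e)"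
  have Y: "Y \<subseteq> seqs kappa lam"
    unfolding Y_def measure_support_def by (auto simp: topspace_X)
  \<comment> \<open>A letter outside \<open>range e\<close> at place n gives the neighbourhood of
    the first n + 1 letters an empty preimage, so \<open>x\<close> lies in a null open set.\<close>
  have Y_range: "x (c n) \<in> range e" if x: "x \<in> Y" for x n
  proof (rule ccontr)
    assume n: "x (c n) \<notin> range e"
    have xs: "x \<in> seqs kappa lam" using x Y by blast
    have "preim (nbhd x (Suc n)) = {}"
    proof -
      have "enc t \<notin> nbhd x (Suc n)" for t
        using n by (metis enc_c lessI mem_nbhd_iff rangeI)
      then show ?thesis by (simp add: preim_def)
    qed
    then have "\<mu> (nbhd x (Suc n)) = Some \<one>\<^bsub>ennreal_monoid \<iota>\<^esub>"
      using openin_nbhd[OF xs] by (simp add: \<mu>_def open_in_\<MM> \<nu>_open)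
    moreover have "x \<in> nbhd x (Suc n)"
      using xs by (simp add: mem_nbhd_iff)
    ultimately show False
      using x openin_nbhd[OF xs] unfolding Y_def measure_support_def by blast
  qed
  have "countable (seqs_lt kappa (range e))"
    unfolding seqs_lt_def
  proof (intro countable_SIGMA)
    show "countable (Field kappa)"
      using bij_c by (metis bij_betw_def uncountable_def countable_image countableI_type)
    show "countable (underS kappa \<alpha> \<rightarrow>\<^sub>E range e)" if "\<alpha> \<in> Field kappa" for \<alpha>
    proof (rule countable_PiE)
      obtain n where "\<alpha> = c n"
        using \<open>\<alpha> \<in> Field kappa\<close> bij_c unfolding bij_betw_def by blast
      then show "finite (underS kappa \<alpha>)" by (simp add: underS_c)
    qed auto
  qed
  then have count: "countable \<B>"
    unfolding \<B>_def by (rule countable_image)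
  have "is_base (subtopology X Y) \<B>"
    unfolding is_base_def
  proof (intro conjI ballI allI impI)
    fix V assume "V \<in> \<B>"
    then obtain s where s: "s \<in> seqs_lt kappa (range e)" "V = Defs.cone kappa lam s \<inter> Y"
      by (auto simp: \<B>_def)
    have "seqs_lt kappa (range e) \<subseteq> seqs_lt kappa (Field lam)"
      unfolding seqs_lt_def using e_in_Field by (intro Sigma_mono PiE_mono) auto
    then have "s \<in> seqs_lt kappa (Field lam)"
      using s(1) by blast
    then show "openin (subtopology X Y) V"
      using s(2) openin_cone unfolding openin_subtopology by blast
  next
    fix U x assume "openin (subtopology X Y) U \<and> x \<in> U"
    then obtain U' where U': "openin X U'" "U = U' \<inter> Y" "x \<in> U'" "x \<in> Y"
      by (auto simp: openin_subtopology)
    obtain n where n: "nbhd x n \<subseteq> U'"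
      using nbhd_subset_open[OF U'(1,3)] .
    have "seq_restrict kappa x (c n) \<in> seqs_lt kappa (range e)"
      using Y_range[OF U'(4)] by (auto simp: seq_restrict_def seqs_lt_def underS_c)
    then have "nbhd x n \<inter> Y \<in> \<B>"
      unfolding nbhd_def \<B>_def by blast
    moreover have "x \<in> nbhd x n"
      using Y U'(4) by (auto simp: mem_nbhd_iff)
    ultimately show "\<exists>V\<in>\<B>. x \<in> V \<and> V \<subseteq> U"
      using n U' by blast
  qed
  then have "weight (subtopology X Y) \<le>o |\<B>|"
    using weight_works by blast
  also have "|\<B>| \<le>o natLeq"
  proof -
    have "|\<B>| \<le>o |UNIV :: nat set|"
      using count card_of_ordLeq[of \<B> "UNIV :: nat set"] by (auto simp: countable_def)
    then show ?thesis
      using card_of_nat ordLeq_ordIso_trans by blast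
  qed
  also have "natLeq <o cardSuc natLeq"
    by (rule cardSuc_greater[OF natLeq_Card_order])
  finally show ?thesis
    by (simp add: Dirac_def Y_def)
qed

end

section \<open>Collapse of \<kappa> to \<omega> and conclusion\<close>

theorem proposition5p3:
  fixes kappa :: "'k rel" and lam :: "'l rel" and Ord :: "'o rel"
  assumes "Cinfinite kappa" and "Cinfinite lam" and "kappa \<le>o lam"
    and "regularCard kappa"
    and "|seqs_lt kappa (Field lam)| =o lam"
    and "lam <o ctwo ^c natLeq"
    and "Well_order Ord" and "cardSuc lam \<le>o Ord"
  shows "\<exists>(S :: ('k \<Rightarrow> 'l) set ordered_monoid) Sum \<MM> \<mu>.
    weak_measure_space S Ord Sum lam (bounded_topology kappa lam) \<MM> \<mu> \<and>
    continuous_measure S (bounded_topology kappa lam) \<MM> \<mu> \<and>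
    Dirac (cardSuc natLeq) S (bounded_topology kappa lam) \<mu>"
proof -
  have "ctwo ^c natLeq =o |UNIV :: nat set set|"
    using card_of_Pow_Func[of "UNIV :: nat set"] ordIso_symmetric
    by (auto simp: cexp_def ctwo_def Field_card_of Field_natLeq)
  then have lam_less: "lam <o |UNIV :: nat set set|"
    using assms(6) ordLess_ordIso_trans by blast
  have inf: "infinite (Field lam)"
    using assms(2) by (simp add: cinfinite_def)
  \<comment> \<open>Supplies the letters of the embedding and also the two distinct letters for the
    collapse of \<open>kappa\<close>.\<close>
  obtain e :: "nat \<Rightarrow> 'l" where e: "inj e" "range e \<subseteq> Field lam"
    using infinite_countable_subset[OF inf] by blast
  have "natLeq =o kappa"
  proof (rule natLeq_ordIso_if_seqs_lt_ordLess[OF assms(1)])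
    show "e 0 \<in> Field lam" "e 1 \<in> Field lam" "e 0 \<noteq> e 1"
      using e by (auto simp: inj_eq)
    show "|seqs_lt kappa (Field lam)| <o |UNIV :: nat set set|"
      using assms(5) lam_less ordIso_ordLess_trans by blast
  qed
  \<comment> \<open>The isomorphism from \<omega> onto \<open>kappa\<close> is the required
    enumeration of positions.\<close>
  then obtain c where c: "BNF_Wellorder_Embedding.iso natLeq kappa c"
    by (auto simp: ordIso_def)
  have bij: "bij_betw c UNIV (Field kappa)"
    and le: "(c m, c n) \<in> kappa \<longleftrightarrow> m \<le> n" for m n
    using c unfolding iso_iff2 Field_natLeq by (simp_all add: natLeq_def)
  have "underS kappa (c n) = c ` {..<n}" for n
  proof -
    have c: "inj c" "Field kappa = range c"
      using bij by (auto simp: bij_betw_def)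
    have "x \<in> c ` {..<n}" if x: "x \<noteq> c n" "(x, c n) \<in> kappa" for x
    proof -
      obtain m where "x = c m"
        using FieldI1[OF x(2)] c(2) by blast
      then show ?thesis
        using x by (cases "m = n") (auto simp: le)
    qed
    then show ?thesis
      using c(1) by (auto simp: underS_def le inj_eq)
  qed
  then interpret dyadic_measure kappa lam c e
    using assms(1,2) lam_less bij e by unfold_locales (auto intro: card_order_on_well_order_on)
  show ?thesis
    using weak_measure_space[OF assms(7)] continuous_measure Dirac by blast
qed

end
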